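(* Let $d\ge 1$ and let $(V,H),(V,H')\in\mathrm{TBPav}(d)$. Then $(V,H\cup H')\in\mathrm{TBPav}(d)$.
   Context: A simplicial complex is a pair $(V,H)$ with $V$ finite nonempty, $H\subseteq 2^V$ containing all singletons and closed under subsets; its dimension is $\max\{|X|:X\in H\}-1$. $P_{\le k}(V)$ is the set of subsets of $V$ with at most $k$ elements. A complex of dimension $d$ is paving if $P_{\le d}(V)\subseteq H$. A flat is a set $F\subseteq V$ such that $X\cup\{p\}\in H$ for every $X\in H$ with $X\subseteq F$ and every $p\in V\setminus F$. For a chain $F_0\subset\cdots\subset F_k$, a transversal of its successive differences is a set $\{x_1,\dots,x_k\}$ with $x_i\in F_i\setminus F_{i-1}$. A complex is boolean representable (BRSC) if it has a boolean matrix representation; equivalently every face is a transversal of the successive differences of some chain of flats. The $k$-truncation of $(V,H)$ is $(V,H\cap P_{\le k}(V))$; a TBRSC is a complex equal to the $k$-truncation of some BRSC for some $k\ge1$. $\mathrm{TBPav}(d)$ is the class of paving TBRSCs of dimension $d$. *)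

theory Defs
  imports Main
begin

type_synonym 'a scomplex = "'a set \<times> 'a set set"

definition simplicial_complex :: "'a scomplex \<Rightarrow> bool" where
  "simplicial_complex = (\<lambda>(V, H). finite V \<and> V \<noteq> {} \<and> H \<subseteq> Pow V \<and>
     (\<forall>v\<in>V. {v} \<in> H) \<and> (\<forall>X\<in>H. \<forall>Y. Y \<subseteq> X \<longrightarrow> Y \<in> H))"

text \<open>On a simplicial complex the maximum is at least 1, so the subtraction does not truncate.\<close>

definition dimension :: "'a scomplex \<Rightarrow> nat" where
  "dimension = (\<lambda>(V, H). Max (card ` H) - 1)"

definition subsets_upto :: "nat \<Rightarrow> 'a set \<Rightarrow> 'a set set" where
  "subsets_upto k V = {X. X \<subseteq> V \<and> card X \<le> k}"

definition paving :: "'a scomplex \<Rightarrow> bool" where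
  "paving = (\<lambda>(V, H). subsets_upto (dimension (V, H)) V \<subseteq> H)"

text \<open>
  A boolean matrix with m rows and columns indexed by V is a function M, where only the
  entries M i v with i < m and v \<in> V matter.  A set of columns X is independent if some
  square submatrix with column set X becomes lower unitriangular after permuting its rows and its
  columns; the lists rs and xs are the permuted rows and columns.
\<close>

definition lower_unitriangular :: "(nat \<Rightarrow> 'a \<Rightarrow> bool) \<Rightarrow> nat list \<Rightarrow> 'a list \<Rightarrow> bool" where
  "lower_unitriangular M rs xs \<longleftrightarrow> length rs = length xs \<and>
     (\<forall>i<length xs. M (rs ! i) (xs ! i)) \<and>
     (\<forall>i j. i < j \<and> j < length xs \<longrightarrow> \<not> M (rs ! i) (xs ! j))"

definition independent_columns :: "nat \<Rightarrow> (nat \<Rightarrow> 'a \<Rightarrow> bool) \<Rightarrow> 'a set \<Rightarrow> bool" where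
  "independent_columns m M X \<longleftrightarrow> (\<exists>rs xs. distinct rs \<and> set rs \<subseteq> {..<m} \<and>
     distinct xs \<and> set xs = X \<and> lower_unitriangular M rs xs)"

definition BRSC :: "'a scomplex \<Rightarrow> bool" where
  "BRSC = (\<lambda>(V, H). simplicial_complex (V, H) \<and>
     (\<exists>m M. H = {X. X \<subseteq> V \<and> independent_columns m M X}))"

definition truncation :: "nat \<Rightarrow> 'a scomplex \<Rightarrow> 'a scomplex" where
  "truncation k = (\<lambda>(V, H). (V, H \<inter> subsets_upto k V))"

definition TBRSC :: "'a scomplex \<Rightarrow> bool" where
  "TBRSC C \<longleftrightarrow> simplicial_complex C \<and> (\<exists>k\<ge>1. \<exists>B. BRSC B \<and> C = truncation k B)"

definition TBPav :: "nat \<Rightarrow> 'a scomplex set" where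
  "TBPav d = {C. TBRSC C \<and> paving C \<and> dimension C = d}"

definition flat :: "'a scomplex \<Rightarrow> 'a set \<Rightarrow> bool" where
  "flat = (\<lambda>(V, H) F. F \<subseteq> V \<and> (\<forall>X\<in>H. X \<subseteq> F \<longrightarrow> (\<forall>p\<in>V - F. insert p X \<in> H)))"

text \<open>The chain is F 0, ..., F k and its i-th difference is F (Suc i) - F i.\<close>

definition flat_transversal :: "'a scomplex \<Rightarrow> 'a set \<Rightarrow> bool" where
  "flat_transversal C X \<longleftrightarrow> (\<exists>k F x. (\<forall>i\<le>k. flat C (F i)) \<and> (\<forall>i<k. F i \<subset> F (Suc i)) \<and>
     (\<forall>i<k. x i \<in> F (Suc i) - F i) \<and> X = x ` {..<k})"

lemma zero_set_flat:
  assumes H: "H = {X. X \<subseteq> V \<and> independent_columns m M X}" and r: "r < m"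
  shows "flat (V, H) {v \<in> V. \<not> M r v}"
proof -
  have "insert p X \<in> H" if X: "X \<in> H" "X \<subseteq> {v \<in> V. \<not> M r v}" and p: "p \<in> V" "M r p" for X p
  proof -
    from X(1) H obtain rs xs where rx: "distinct rs" "set rs \<subseteq> {..<m}" "distinct xs" "set xs = X"
      "lower_unitriangular M rs xs" by (auto simp: independent_columns_def)
    have 1: "r \<notin> set rs"
    proof
      assume "r \<in> set rs"
      then obtain i where i: "i < length rs" "rs ! i = r" by (auto simp: in_set_conv_nth)
      then have "M r (xs ! i)" "xs ! i \<in> X"
        using rx(4,5) by (auto simp: lower_unitriangular_def)
      then show False using X(2) by auto
    qed
    have 2: "p \<notin> set xs" using rx(4) X(2) p by auto
    have "lower_unitriangular M (r # rs) (p # xs)"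
      unfolding lower_unitriangular_def
    proof (intro conjI allI impI)
      show "length (r # rs) = length (p # xs)"
        using rx(5) by (simp add: lower_unitriangular_def)
    next
      fix i assume "i < length (p # xs)"
      then show "M ((r # rs) ! i) ((p # xs) ! i)"
        using rx(5) p by (cases i) (auto simp: lower_unitriangular_def)
    next
      fix i j assume ij: "i < j \<and> j < length (p # xs)"
      then obtain j' where j': "j = Suc j'" by (cases j) auto
      with ij have "xs ! j' \<in> X" using rx(4) by auto
      with X(2) have "\<not> M r (xs ! j')" by auto
      then show "\<not> M ((r # rs) ! i) ((p # xs) ! j)"
        using ij j' rx(5) by (cases i) (auto simp: lower_unitriangular_def)
    qed
    with rx 1 2 r have "independent_columns m M (insert p X)"
      unfolding independent_columns_def
      by (intro exI[of _ "r # rs"] exI[of _ "p # xs"]) auto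
    then show ?thesis using X p H by auto
  qed
  then show ?thesis by (auto simp: flat_def)
qed

lemma flat_Inter:
  assumes "\<And>i. i \<in> I \<Longrightarrow> flat (V, H) (Z i)"
  shows "flat (V, H) (V \<inter> (\<Inter>i\<in>I. Z i))"
proof -
  have "insert p X \<in> H"
    if X: "X \<in> H" "X \<subseteq> V \<inter> (\<Inter>i\<in>I. Z i)" and p: "p \<in> V - V \<inter> (\<Inter>i\<in>I. Z i)" for X p
  proof -
    from p obtain i where i: "i \<in> I" "p \<in> V - Z i" by auto
    with X(2) have "X \<subseteq> Z i" by auto
    with assms[OF i(1)] X(1) i(2) show ?thesis by (auto simp: flat_def)
  qed
  then show ?thesis by (auto simp: flat_def)
qed

lemma independent_imp_flat_transversal:
  assumes H: "H = {X. X \<subseteq> V \<and> independent_columns m M X}" and X: "X \<in> H"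
  shows "flat_transversal (V, H) X"
proof -
  from X H obtain rs xs where rx: "distinct rs" "set rs \<subseteq> {..<m}" "distinct xs" "set xs = X"
    "lower_unitriangular M rs xs" and XV: "X \<subseteq> V" by (auto simp: independent_columns_def)
  define k where "k = length xs"
  have len: "length rs = k" using rx(5) by (simp add: k_def lower_unitriangular_def)
  define F where "F i = V \<inter> (\<Inter>l\<in>{..<k - i}. {v \<in> V. \<not> M (rs ! l) v})" for i
  define x where "x i = xs ! (k - Suc i)" for i
  have "flat (V, H) (F i)" for i
    unfolding F_def
  proof (rule flat_Inter)
    fix l assume "l \<in> {..<k - i}"
    then have "l < length rs" using len by auto
    then have "rs ! l < m" using rx(2) nth_mem[of l rs] by (metis lessThan_iff subsetD)
    then show "flat (V, H) {v \<in> V. \<not> M (rs ! l) v}" by (rule zero_set_flat[OF H])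
  qed
  moreover have xF: "x i \<in> F (Suc i) - F i" if "i < k" for i
  proof -
    have kd: "k - Suc i < k" using that by auto
    then have "x i \<in> V" using rx(4) XV by (auto simp: x_def k_def)
    moreover have "M (rs ! (k - Suc i)) (x i)"
      using rx(5) kd by (simp add: lower_unitriangular_def x_def k_def)
    moreover have "\<not> M (rs ! l) (x i)" if "l < k - Suc i" for l
      using rx(5) kd that by (simp add: lower_unitriangular_def x_def k_def)
    ultimately show ?thesis using that by (auto simp: F_def intro!: bexI[of _ "k - Suc i"])
  qed
  moreover have "F i \<subset> F (Suc i)" if "i < k" for i
  proof -
    have "F i \<subseteq> F (Suc i)" by (auto simp: F_def)
    with xF[OF that] show ?thesis by auto
  qed
  moreover have "X = x ` {..<k}"
  proof -
    have "x ` {..<k} = (!) xs ` ((\<lambda>i. k - Suc i) ` {..<k})" by (auto simp: x_def)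
    also have "(\<lambda>i. k - Suc i) ` {..<k} = {..<k}"
    proof
      show "{..<k} \<subseteq> (\<lambda>i. k - Suc i) ` {..<k}"
      proof
        fix j assume "j \<in> {..<k}"
        then show "j \<in> (\<lambda>i. k - Suc i) ` {..<k}" by (intro image_eqI[of _ _ "k - Suc j"]) auto
      qed
    qed auto
    also have "(!) xs ` {..<k} = X" using rx(4) by (auto simp: k_def in_set_conv_nth)
    finally show ?thesis by simp
  qed
  ultimately show ?thesis unfolding flat_transversal_def
    by (intro exI[of _ k] exI[of _ F] exI[of _ x]) blast
qed

lemma flat_transversal_imp_BRSC:
  assumes C: "simplicial_complex (V, H)" and T: "\<And>X. X \<in> H \<Longrightarrow> flat_transversal (V, H) X"
  shows "BRSC (V, H)"
proof -
  have fin: "finite V" and HV: "H \<subseteq> Pow V" and ne: "V \<noteq> {}" and sing: "\<forall>v\<in>V. {v} \<in> H"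
    and sub: "\<forall>X\<in>H. \<forall>Y. Y \<subseteq> X \<longrightarrow> Y \<in> H"
    using C by (auto simp: simplicial_complex_def)
  have e: "{} \<in> H" using ne sing sub by blast
  have "finite {F. flat (V, H) F}"
    by (rule finite_subset[of _ "Pow V"]) (auto simp: flat_def fin)
  then obtain m and Fl :: "nat \<Rightarrow> 'a set" where Fl: "{F. flat (V, H) F} = Fl ` {i. i < m}" "inj_on Fl {i. i < m}"
    using finite_imp_nat_seg_image_inj_on by metis
  define M where "M i v \<longleftrightarrow> v \<notin> Fl i" for i v
  have "X \<in> H" if XV: "X \<subseteq> V" and ind: "independent_columns m M X" for X
  proof -
    from ind obtain rs xs where rx: "set rs \<subseteq> {..<m}" "set xs = X"
      "lower_unitriangular M rs xs" by (auto simp: independent_columns_def)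
    have len: "length rs = length xs" using rx(3) by (simp add: lower_unitriangular_def)
    have "set (drop (length xs - n) xs) \<in> H" if "n \<le> length xs" for n
      using that
    proof (induction n)
      case 0
      then show ?case using e by simp
    next
      case (Suc n)
      let ?i = "length xs - Suc n"
      have i: "?i < length xs" "Suc ?i = length xs - n" using Suc.prems by auto
      have d: "drop ?i xs = xs ! ?i # drop (length xs - n) xs"
        using i Cons_nth_drop_Suc[of ?i xs] by simp
      have "rs ! ?i < m" using rx(1) len i nth_mem[of ?i rs] by (metis lessThan_iff subsetD)
      then have fl: "flat (V, H) (Fl (rs ! ?i))" using Fl by auto
      have "xs ! ?i \<in> V - Fl (rs ! ?i)"
        using rx i XV nth_mem[of ?i xs] by (auto simp: lower_unitriangular_def M_def)
      moreover have "set (drop (length xs - n) xs) \<subseteq> Fl (rs ! ?i)"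
      proof
        fix y assume "y \<in> set (drop (length xs - n) xs)"
        then obtain j where j: "j < n" "y = xs ! (length xs - n + j)"
          using Suc.prems by (auto simp: in_set_conv_nth)
        have "?i < length xs - n + j" "length xs - n + j < length xs"
          using j(1) Suc.prems by auto
        then show "y \<in> Fl (rs ! ?i)" using rx(3) unfolding j(2) lower_unitriangular_def M_def
          by blast
      qed
      moreover have "set (drop (length xs - n) xs) \<in> H" using Suc by simp
      ultimately show ?case using fl unfolding d by (simp add: flat_def)
    qed
    from this[of "length xs"] show ?thesis using rx(2) by simp
  qed
  moreover have "independent_columns m M X" if X: "X \<in> H" for X
  proof -
    from T[OF X] obtain k F x where kF: "\<forall>i\<le>k. flat (V, H) (F i)" "\<forall>i<k. F i \<subset> F (Suc i)"
      "\<forall>i<k. x i \<in> F (Suc i) - F i" "X = x ` {..<k}"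
      unfolding flat_transversal_def by blast
    have mono: "F i \<subseteq> F j" if "i \<le> j" "j \<le> k" for i j
      using that
    proof (induction j rule: dec_induct)
      case (step n)
      then have "F n \<subset> F (Suc n)" using kF(2) by simp
      with step show ?case by auto
    qed simp
    define g where "g i = (SOME n. n < m \<and> F i = Fl n)" for i
    have g: "g i < m \<and> F i = Fl (g i)" if "i \<le> k" for i
    proof -
      have "F i \<in> Fl ` {i. i < m}" using kF(1) that unfolding Fl(1)[symmetric] by simp
      then have "\<exists>n. n < m \<and> F i = Fl n" by blast
      then show ?thesis unfolding g_def by (rule someI_ex)
    qed
    have xd: "x i \<noteq> x j" if "i < j" "j < k" for i j
    proof -
      have "x i \<in> F (Suc i)" using kF(3) that by simp
      moreover have "F (Suc i) \<subseteq> F j" using mono that by simp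
      moreover have "x j \<notin> F j" using kF(3) that by simp
      ultimately show ?thesis by auto
    qed
    have gd: "g i \<noteq> g j" if "i < j" "j < k" for i j
    proof
      assume "g i = g j"
      then have "F i = F j" using g[of i] g[of j] that by simp
      moreover have "F i \<subset> F (Suc i)" using kF(2) that by auto
      ultimately show False using mono[of "Suc i" j] that by auto
    qed
    define xs where "xs = rev (map x [0..<k])"
    define rs where "rs = rev (map g [0..<k])"
    have "inj_on x {0..<k}" "inj_on g {0..<k}"
      by (rule linorder_inj_onI; (rule linear | simp add: xd gd))+
    then have "distinct xs" "distinct rs" by (simp_all add: xs_def rs_def distinct_map)
    moreover have "set xs = X" using kF(4) by (auto simp: xs_def)
    moreover have "set rs \<subseteq> {..<m}" using g by (auto simp: rs_def)
    moreover have "lower_unitriangular M rs xs"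
      unfolding lower_unitriangular_def
    proof (intro conjI allI impI)
      show "length rs = length xs" by (simp add: xs_def rs_def)
    next
      fix i assume "i < length xs"
      then have i: "i < k" by (simp add: xs_def)
      then have "x (k - Suc i) \<notin> F (k - Suc i)" using kF(3) by simp
      with i show "M (rs ! i) (xs ! i)"
        using g[of "k - Suc i"] by (auto simp: xs_def rs_def rev_nth M_def)
    next
      fix i j assume "i < j \<and> j < length xs"
      then have ij: "i < j" "j < k" by (auto simp: xs_def)
      have "x (k - Suc j) \<in> F (Suc (k - Suc j))" using kF(3) ij by auto
      also have "\<dots> \<subseteq> F (k - Suc i)" by (rule mono) (use ij in auto)
      finally show "\<not> M (rs ! i) (xs ! j)"
        using g[of "k - Suc i"] ij by (auto simp: xs_def rs_def rev_nth M_def)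
    qed
    ultimately show ?thesis by (auto simp: independent_columns_def)
  qed
  ultimately have "H = {X. X \<subseteq> V \<and> independent_columns m M X}" using HV by auto
  then show ?thesis using C by (auto simp: BRSC_def)
qed

theorem BRSC_iff_flat_transversal:
  "BRSC (V, H) \<longleftrightarrow> simplicial_complex (V, H) \<and> (\<forall>X\<in>H. flat_transversal (V, H) X)"
proof
  assume "BRSC (V, H)"
  then show "simplicial_complex (V, H) \<and> (\<forall>X\<in>H. flat_transversal (V, H) X)"
    unfolding BRSC_def using independent_imp_flat_transversal by blast
qed (blast intro: flat_transversal_imp_BRSC)

end

theory Submission
  imports Defs
begin

text \<open>
  Stack the boolean matrices M and M' representing two complexes whose truncations are the given
  ones.  If p is the first column and r the first row of a unitriangular submatrix of the stacked
  matrix with at most d + 1 columns X, then X - {p} lies in the zero set of r and has at most d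
  elements.  By paving, X - {p} is a face of both complexes.  The row r comes from M or M', so its
  zero set is a flat of the corresponding complex, and X is a face of that complex.
\<close>

text \<open>The pairs \<open>i < j\<close> with \<open>i = 0\<close> concern only the first row, and
  all other pairs belong to the tails. This recursion replaces index arguments by list
  induction.\<close>

lemma lower_unitriangular_Cons [simp]:
  "lower_unitriangular M (r # rs) (x # xs) \<longleftrightarrow>
     M r x \<and> (\<forall>y\<in>set xs. \<not> M r y) \<and> lower_unitriangular M rs xs" (is "?L \<longleftrightarrow> ?R")
proof
  assume L: ?L
  have "\<not> M r y" if y: "y \<in> set xs" for y
  proof -
    from y obtain j where j: "j < length xs" "y = xs ! j" by (auto simp: in_set_conv_nth)
    have "\<not> M ((r # rs) ! 0) ((x # xs) ! Suc j)"
      using L j unfolding lower_unitriangular_def by (metis Suc_less_eq length_Cons zero_less_Suc)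
    then show ?thesis using j by simp
  qed
  moreover have "lower_unitriangular M rs xs"
    using L unfolding lower_unitriangular_def
    by (metis Suc_inject Suc_less_eq length_Cons nth_Cons_Suc)
  moreover have "M r x"
    using L unfolding lower_unitriangular_def by (metis length_Cons nth_Cons_0 zero_less_Suc)
  ultimately show ?R by blast
next
  assume R: ?R
  then show ?L
    by (auto simp: lower_unitriangular_def less_Suc_eq_0_disj)
qed

text \<open>Deleting a column together with the row paired with it keeps the remaining square matrix
  unitriangular.\<close>

lemma lower_unitriangular_subset:
  assumes "length rs = length xs" "lower_unitriangular M rs xs" "distinct rs" "distinct xs"
    "Y \<subseteq> set xs"
  obtains rs' xs' where "distinct rs'" "set rs' \<subseteq> set rs" "distinct xs'" "set xs' = Y"
    "lower_unitriangular M rs' xs'"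
proof -
  from assms have "\<exists>rs' xs'. distinct rs' \<and> set rs' \<subseteq> set rs \<and> distinct xs' \<and> set xs' = Y \<and>
    lower_unitriangular M rs' xs'"
  proof (induction rs xs arbitrary: Y rule: list_induct2)
    case Nil
    then show ?case by auto
  next
    case (Cons r rs x xs)
    \<comment> \<open>The induction hypothesis handles \<open>Y\<close> without \<open>x\<close>. If
      \<open>x\<close> lies in \<open>Y\<close>, it returns in front with its row \<open>r\<close>,
      which vanishes on all of \<open>set xs\<close>.\<close>
    have "Y - {x} \<subseteq> set xs" using Cons.prems by auto
    with Cons obtain rs' xs' where *: "distinct rs'" "set rs' \<subseteq> set rs" "distinct xs'"
      "set xs' = Y - {x}" "lower_unitriangular M rs' xs'"
      by (metis distinct.simps(2) lower_unitriangular_Cons)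
    show ?case
    proof (cases "x \<in> Y")
      case True
      have "\<forall>y\<in>set xs'. \<not> M r y" "M r x" using * Cons.prems by auto
      with * True Cons.prems show ?thesis
        by (intro exI[of _ "r # rs'"] exI[of _ "x # xs'"]) auto
    next
      case False
      with * show ?thesis by (intro exI[of _ rs'] exI[of _ xs']) auto
    qed
  qed
  then show ?thesis using that by blast
qed

lemma independent_columns_subset:
  assumes "independent_columns m M X" "Y \<subseteq> X"
  shows "independent_columns m M Y"
proof -
  from assms obtain rs xs where rx: "distinct rs" "set rs \<subseteq> {..<m}" "distinct xs" "set xs = X"
    "lower_unitriangular M rs xs" by (auto simp: independent_columns_def)
  then have "length rs = length xs" by (simp add: lower_unitriangular_def)
  then obtain rs' xs' where "distinct rs'" "set rs' \<subseteq> set rs" "distinct xs'" "set xs' = Y"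
    "lower_unitriangular M rs' xs'"
    using lower_unitriangular_subset rx assms(2) by metis
  with rx(2) show ?thesis unfolding independent_columns_def by blast
qed

text \<open>Places a matrix as a block of rows inside a larger one. Injectivity of \<open>f\<close>
  keeps the chosen rows distinct.\<close>

lemma independent_columns_reindex:
  assumes "independent_columns m M X" "inj_on f {..<m}" "f ` {..<m} \<subseteq> {..<n}"
    and N: "\<And>i. i < m \<Longrightarrow> N (f i) = M i"
  shows "independent_columns n N X"
proof -
  from assms(1) obtain rs xs where rx: "distinct rs" "set rs \<subseteq> {..<m}" "distinct xs" "set xs = X"
    "lower_unitriangular M rs xs" by (auto simp: independent_columns_def)
  have len: "length rs = length xs" using rx(5) by (simp add: lower_unitriangular_def)
  have "N (map f rs ! i) = M (rs ! i)" if "i < length xs" for i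
  proof -
    have "rs ! i \<in> set rs" using that len by simp
    then have "rs ! i < m" using rx(2) by auto
    then show ?thesis using that len N by simp
  qed
  then have "lower_unitriangular N (map f rs) xs"
    using rx(5) by (simp add: lower_unitriangular_def)
  moreover have "distinct (map f rs)"
    using rx(1,2) assms(2) by (auto simp: distinct_map intro: inj_on_subset)
  moreover have "set (map f rs) \<subseteq> {..<n}" using rx(2) assms(3) by auto
  ultimately show ?thesis using rx(3,4) unfolding independent_columns_def by blast
qed

text \<open>Splits off the first row and column of a unitriangular submatrix; together with the next
  lemma it allows the remaining columns to be treated in a different matrix.\<close>

lemma independent_columns_cases:
  assumes "independent_columns m M X"
  obtains "X = {}"
  | r p Y where "r < m" "X = insert p Y" "p \<notin> Y" "M r p" "\<And>y. y \<in> Y \<Longrightarrow> \<not> M r y"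
proof -
  from assms obtain rs xs where rx: "set rs \<subseteq> {..<m}" "distinct xs" "set xs = X"
    "lower_unitriangular M rs xs" by (auto simp: independent_columns_def)
  have len: "length rs = length xs" using rx(4) by (simp add: lower_unitriangular_def)
  show thesis
  proof (cases xs)
    case Nil
    then show ?thesis using that(1) rx by simp
  next
    case (Cons p ps)
    with len obtain r rs' where "rs = r # rs'" by (cases rs) auto
    with Cons rx show ?thesis by (intro that(2)[of r p "set ps"]) auto
  qed
qed

lemma independent_columns_insert:
  assumes "independent_columns m M Y" "r < m" "M r p" "\<And>y. y \<in> Y \<Longrightarrow> \<not> M r y"
  shows "independent_columns m M (insert p Y)"
  proof -
  \<comment> \<open>Flatness of zero sets holds over any ground set, so \<open>UNIV\<close> serves
    where no \<open>V\<close> is given.\<close>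
  have "flat (UNIV, {X. X \<subseteq> UNIV \<and> independent_columns m M X}) {v \<in> UNIV. \<not> M r v}"
    using zero_set_flat[OF refl assms(2)] .
  then show ?thesis using assms(1,3,4) by (auto simp: flat_def)
qed

text \<open>Since \<open>d \<ge> 1\<close>, the natural subtraction in \<open>dimension\<close> is
  not cut off at 0 and can be inverted.\<close>

lemma Max_card_faces:
  assumes "simplicial_complex (V, H)" "dimension (V, H) = d" "d \<ge> 1"
  shows "Max (card ` H) = Suc d" "finite H" "H \<noteq> {}"
proof -
  have "finite (Pow V)" "H \<subseteq> Pow V" "V \<noteq> {}" "\<forall>v\<in>V. {v} \<in> H"
    using assms(1) by (simp_all add: simplicial_complex_def)
  then show "finite H" "H \<noteq> {}" by (blast intro: finite_subset)+
  show "Max (card ` H) = Suc d" using assms(2,3) by (simp add: dimension_def)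
qed

text \<open>Fixes the truncation level at \<open>Suc d\<close> and reduces the BRSC to its matrix,
  so that members over the same \<open>V\<close> can be compared through their matrices
  alone.\<close>

lemma TBPav_iff:
  assumes "d \<ge> 1"
  shows "(V, H) \<in> TBPav d \<longleftrightarrow> finite V \<and> subsets_upto d V \<subseteq> H \<and> (\<exists>X\<in>H. card X = Suc d) \<and>
    (\<exists>m M. H = {X. X \<subseteq> V \<and> card X \<le> Suc d \<and> independent_columns m M X})" (is "?L \<longleftrightarrow> ?R")
proof
  assume ?L
  then have S: "simplicial_complex (V, H)" and P: "paving (V, H)" and D: "dimension (V, H) = d"
    and "\<exists>k B. BRSC B \<and> (V, H) = truncation k B"
    by (auto simp: TBPav_def TBRSC_def)
  then obtain k m M where H: "H = {X. X \<subseteq> V \<and> independent_columns m M X} \<inter> subsets_upto k V"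
    by (auto simp: BRSC_def truncation_def)
  note mx = Max_card_faces[OF S D assms]
  obtain X where X: "X \<in> H" "card X = Suc d"
  proof -
    have "Suc d \<in> card ` H" using Max_in[of "card ` H"] mx by simp
    then show ?thesis using that by (metis imageE)
  qed
  have le: "card Y \<le> Suc d" if "Y \<in> H" for Y
    using Max_ge[of "card ` H" "card Y"] mx that by simp
  \<comment> \<open>A face of size \<open>Suc d\<close> survived the truncation. As no face is
    larger, truncating at \<open>Suc d\<close> instead of \<open>k\<close> gives the same
    complex.\<close>
  have "Suc d \<le> k" using X H by (auto simp: subsets_upto_def)
  with le H have "H = {X. X \<subseteq> V \<and> card X \<le> Suc d \<and> independent_columns m M X}"
    by (auto simp: subsets_upto_def)
  moreover have "finite V" "subsets_upto d V \<subseteq> H"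
    using S P D by (auto simp: simplicial_complex_def paving_def)
  ultimately show ?R using X by blast
next
  assume ?R
  then obtain X m M where fin: "finite V" and P: "subsets_upto d V \<subseteq> H"
    and X: "X \<in> H" "card X = Suc d"
    and H: "H = {X. X \<subseteq> V \<and> card X \<le> Suc d \<and> independent_columns m M X}" by blast
  \<comment> \<open>The BRSC to be truncated: the size bound is dropped and all independent column
    sets are kept.\<close>
  define B where "B = {X. X \<subseteq> V \<and> independent_columns m M X}"
  have ne: "V \<noteq> {}" using X H by auto
  \<comment> \<open>Singletons are within reach of paving because \<open>d \<ge> 1\<close>.\<close>
  have sing: "{v} \<in> H" if "v \<in> V" for v
    using P that assms by (auto simp: subsets_upto_def)
  have sB: "simplicial_complex (V, B)"
    using fin ne sing by (auto simp: simplicial_complex_def B_def H intro: independent_columns_subset)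
  have tr: "(V, H) = truncation (Suc d) (V, B)"
    by (auto simp: truncation_def B_def H subsets_upto_def)
  have down: "Y \<in> H" if "Z \<in> H" "Y \<subseteq> Z" for Y Z
  proof -
    have "Z \<subseteq> V" "card Z \<le> Suc d" using that by (auto simp: H)
    with fin that(2) have "card Y \<le> Suc d"
      by (meson card_mono finite_subset le_trans)
    then show ?thesis using that independent_columns_subset[of m M Z Y] by (auto simp: H)
  qed
  have HV: "H \<subseteq> Pow V" by (auto simp: H)
  have sH: "simplicial_complex (V, H)"
    unfolding simplicial_complex_def using fin ne sing HV down by blast
  have "finite H" using fin by (auto simp: H)
  moreover have "Suc d \<in> card ` H" using X by (metis imageI)
  ultimately have "Max (card ` H) = Suc d" by (intro Max_eqI) (auto simp: H)
  then have dim: "dimension (V, H) = d" by (simp add: dimension_def)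
  have "BRSC (V, B)" using sB unfolding BRSC_def B_def by blast
  then have "TBRSC (V, H)" using sH tr unfolding TBRSC_def
    by (intro conjI exI[of _ "Suc d"] exI[of _ "(V, B)"]) auto
  then show ?L using dim P by (simp add: TBPav_def paving_def)
qed

theorem theorem6p8:
  fixes V :: "'a set" and H H' :: "'a set set" and d :: nat
  assumes "d \<ge> 1"
    and "(V, H) \<in> TBPav d"
    and "(V, H') \<in> TBPav d"
  shows "(V, H \<union> H') \<in> TBPav d"
proof -
  from assms(2) obtain m M where fin: "finite V" and P: "subsets_upto d V \<subseteq> H"
    and X: "\<exists>X\<in>H. card X = Suc d"
    and H: "H = {X. X \<subseteq> V \<and> card X \<le> Suc d \<and> independent_columns m M X}"
    unfolding TBPav_iff[OF assms(1)] by blast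
  from assms(3) obtain m' M' where P': "subsets_upto d V \<subseteq> H'"
    and H': "H' = {X. X \<subseteq> V \<and> card X \<le> Suc d \<and> independent_columns m' M' X}"
    unfolding TBPav_iff[OF assms(1)] by blast
  define N where "N i = (if i < m then M i else M' (i - m))" for i
  have "independent_columns (m + m') N X" if "independent_columns m M X" for X
    by (rule independent_columns_reindex[OF that, of id]) (auto simp: N_def)
  moreover have "independent_columns (m + m') N X" if "independent_columns m' M' X" for X
    by (rule independent_columns_reindex[OF that, of "(+) m"]) (auto simp: N_def)
  moreover have "X \<in> H \<union> H'"
    if X: "X \<subseteq> V" "card X \<le> Suc d" and ind: "independent_columns (m + m') N X" for X
    using ind
  proof (cases rule: independent_columns_cases)
    case 1
    then show ?thesis using P by (auto simp: subsets_upto_def)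
  next
    case (2 r p Y)
    \<comment> \<open>Finiteness gives \<open>card X = Suc (card Y)\<close>, so \<open>Y\<close> is
      small enough for paving in both complexes, before it is known which block contains
      \<open>r\<close>.\<close>
    have "finite Y" using X(1) 2 fin by (auto intro: finite_subset)
    then have "Y \<in> subsets_upto d V" using X 2 by (auto simp: subsets_upto_def)
    then have ind: "independent_columns m M Y" "independent_columns m' M' Y"
      using P P' by (auto simp: H H')
    show ?thesis
    proof (cases "r < m")
      case True
      then have "independent_columns m M X"
        unfolding 2(2) using 2 by (intro independent_columns_insert[OF ind(1)]) (auto simp: N_def)
      then show ?thesis using X by (simp add: H)
    next
      case False
      \<comment> \<open>Row \<open>r\<close> of \<open>N\<close> is row \<open>r - m\<close> of
        \<open>M'\<close>, and \<open>r < m + m'\<close> keeps this index below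
        \<open>m'\<close>.\<close>
      then have "independent_columns m' M' X"
        unfolding 2(2) using 2
        by (intro independent_columns_insert[OF ind(2), of "r - m"]) (auto simp: N_def)
      then show ?thesis using X by (simp add: H')
    qed
  qed
  ultimately have "H \<union> H' = {X. X \<subseteq> V \<and> card X \<le> Suc d \<and> independent_columns (m + m') N X}"
    by (auto simp: H H')
  then show ?thesis unfolding TBPav_iff[OF assms(1)] using fin P X by blast
qed

end
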